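(* Let $z\in\mathbb{C}\setminus\{-\alpha\}$ be such that $z\notin\mathcal{L}$. Let $q$ be a finite linear combination of exponential solutions of the partial differential equation $L(z)\Delta(z)q=0$, i.e. $q=\sum_{(\rho,\nu)\in V}q_{(\rho,\nu)}$ with $V$ a finite subset of $\mathcal{N}(P_z)$ and $q_{(\rho,\nu)}(x,y)=\gamma_{(\rho,\nu)}e^{\rho x}e^{\nu y}$, where the $\gamma_{(\rho,\nu)}$ are some constants in $\mathbb{C}$. Then $\Delta(z)q=0$ if and only if $$\sum_{i=1}^N\sum_{(\rho,\nu)\in V}\frac{(K_i(z)L_i(z)-L_i(z)K_i(z))\,q_{(\rho,\nu)}}{(k_i^2(z)-\rho^2)(k_i^2(z)-\nu^2)}=0 .$$
   Context: Fix $a,b>0$, $\bar\Omega=[-a,a]\times[-b,b]$ with interior $\Omega$, and write $r=(x,y)\in\bar\Omega$, $\|r\|_1=|x|+|y|$. Let $Y=C(\bar\Omega)$ be the space of continuous complex-valued functions on $\bar\Omega$. Fix an integer $N\ge1$, reals $\alpha>0$, $\tau_0>0$, a real number $S'(0)\neq0$ (the derivative at $0$ of a firing rate function $S$), and complex numbers $\hat c_i\neq0$, $\xi_i$ ($i=1,\dots,N$) such that $J(r,r')=\sum_{i=1}^N\hat c_i e^{-\xi_i\|r-r'\|_1}$ is real-valued on $\bar\Omega\times\bar\Omega$. For $z\in\mathbb{C}$ put $k_i(z)=z+\xi_i$, $c_i(z)=\hat c_iS'(0)e^{-\tau_0z}$ (so $c_i(z)\neq0$), and, for $q\in Y$, $$(K_i(z)q)(r)=c_i(z)\int_\Omega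 e^{-k_i(z)\|r-r'\|_1}q(r')\,dr',\qquad \Delta(z)q=(z+\alpha)q-\sum_{i=1}^NK_i(z)q.$$ Define the differential operators $$L_i(z)=\Bigl(k_i^2(z)-\frac{\partial^2}{\partial x^2}\Bigr)\Bigl(k_i^2(z)-\frac{\partial^2}{\partial y^2}\Bigr),\qquad L(z)=\prod_{i=1}^NL_i(z).$$ They satisfy $L_i(z)K_i(z)q=4c_i(z)k_i^2(z)q$, so the equation $L(z)\Delta(z)q=0$ is the linear constant-coefficient partial differential equation $$(z+\alpha)\prod_{i=1}^NL_i(z)q-4\sum_{i=1}^Nc_i(z)k_i^2(z)\prod_{j\neq i}L_j(z)q=0.$$ Its characteristic polynomial is $$P_z(\rho,\nu)=(z+\alpha)\prod_{i=1}^N(k_i^2(z)-\rho^2)(k_i^2(z)-\nu^2)-4\sum_{i=1}^Nc_i(z)k_i^2(z)\prod_{j\neq i}(k_j^2(z)-\rho^2)(k_j^2(z)-\nu^2),$$ and $\mathcal{N}(P_z)=\{(\rho,\nu)\in\mathbb{C}^2:P_z(\rho,\nu)=0\}$. Finally $$\mathcal{L}=\{z\in\mathbb{C}:\ \exists\, i,j\in\{1,\dots,N\},\ i\ne j,\ k_i^2(z)=k_j^2(z),\ \text{or } \exists\, i,\ k_i(z)=0\}.$$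
   Formalization: It is additionally assumed that all denominators (k_i²(z)−ρ²)(k_i²(z)−ν²), (ρ,ν)∈V, are nonzero; for N≥2, points with ρ²=k_i², ν²=k_j², i≠j, lie in N(P_z) and make the displayed quotients undefined. *)

theory Defs
  imports "HOL-Analysis.Analysis"
begin

text \<open>Elements of $C(\bar\Omega)$ are represented by functions on the whole plane of which only the
  values on the closed rectangle matter: every operator below only looks at these values, and
  equality in $C(\bar\Omega)$ is pointwise equality on \<^term>\<open>Omega_bar a b\<close>.  The families
  $\hat c_i$, $\xi_i$ are functions on the naturals of which only the values on
  \<^term>\<open>{1..N}\<close> matter; \<open>S'0\<close> stands for the number $S'(0)$.\<close>

definition Omega_bar :: "real \<Rightarrow> real \<Rightarrow> (real \<times> real) set" where
  "Omega_bar a b = {-a..a} \<times> {-b..b}"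

definition Omega :: "real \<Rightarrow> real \<Rightarrow> (real \<times> real) set" where
  "Omega a b = interior (Omega_bar a b)"

definition norm1 :: "real \<times> real \<Rightarrow> real" where
  "norm1 r = \<bar>fst r\<bar> + \<bar>snd r\<bar>"

definition connectivity ::
    "nat \<Rightarrow> (nat \<Rightarrow> complex) \<Rightarrow> (nat \<Rightarrow> complex) \<Rightarrow> real \<times> real \<Rightarrow> real \<times> real \<Rightarrow> complex" where
  "connectivity N chat \<xi> r r' = (\<Sum>i=1..N. chat i * exp (- \<xi> i * of_real (norm1 (r - r'))))"

definition k_coeff :: "(nat \<Rightarrow> complex) \<Rightarrow> nat \<Rightarrow> complex \<Rightarrow> complex" where
  "k_coeff \<xi> i z = z + \<xi> i"

definition c_coeff :: "(nat \<Rightarrow> complex) \<Rightarrow> real \<Rightarrow> real \<Rightarrow> nat \<Rightarrow> complex \<Rightarrow> complex" where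
  "c_coeff chat S'0 \<tau>0 i z = chat i * of_real S'0 * exp (- of_real \<tau>0 * z)"

definition K_op ::
    "real \<Rightarrow> real \<Rightarrow> (nat \<Rightarrow> complex) \<Rightarrow> (nat \<Rightarrow> complex) \<Rightarrow> real \<Rightarrow> real \<Rightarrow> nat \<Rightarrow> complex
      \<Rightarrow> (real \<times> real \<Rightarrow> complex) \<Rightarrow> (real \<times> real \<Rightarrow> complex)" where
  "K_op a b chat \<xi> S'0 \<tau>0 i z q = (\<lambda>r. c_coeff chat S'0 \<tau>0 i z *
     integral (Omega a b) (\<lambda>r'. exp (- k_coeff \<xi> i z * of_real (norm1 (r - r'))) * q r'))"

definition Delta_op ::
    "real \<Rightarrow> real \<Rightarrow> nat \<Rightarrow> real \<Rightarrow> (nat \<Rightarrow> complex) \<Rightarrow> (nat \<Rightarrow> complex) \<Rightarrow> real \<Rightarrow> real \<Rightarrow> complex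
      \<Rightarrow> (real \<times> real \<Rightarrow> complex) \<Rightarrow> (real \<times> real \<Rightarrow> complex)" where
  "Delta_op a b N \<alpha> chat \<xi> S'0 \<tau>0 z q = (\<lambda>r. (z + of_real \<alpha>) * q r -
     (\<Sum>i=1..N. K_op a b chat \<xi> S'0 \<tau>0 i z q r))"

text \<open>Partial derivatives of functions on the closed rectangle: on the boundary they are the
  one-sided ones.\<close>

definition partial_x ::
    "real \<Rightarrow> (real \<times> real \<Rightarrow> complex) \<Rightarrow> (real \<times> real \<Rightarrow> complex)" where
  "partial_x a f = (\<lambda>(x, y). vector_derivative (\<lambda>t. f (t, y)) (at x within {-a..a}))"

definition partial_y ::
    "real \<Rightarrow> (real \<times> real \<Rightarrow> complex) \<Rightarrow> (real \<times> real \<Rightarrow> complex)" where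
  "partial_y b f = (\<lambda>(x, y). vector_derivative (\<lambda>t. f (x, t)) (at y within {-b..b}))"

definition L_factor_x ::
    "real \<Rightarrow> complex \<Rightarrow> (real \<times> real \<Rightarrow> complex) \<Rightarrow> (real \<times> real \<Rightarrow> complex)" where
  "L_factor_x a k f = (\<lambda>r. k^2 * f r - partial_x a (partial_x a f) r)"

definition L_factor_y ::
    "real \<Rightarrow> complex \<Rightarrow> (real \<times> real \<Rightarrow> complex) \<Rightarrow> (real \<times> real \<Rightarrow> complex)" where
  "L_factor_y b k f = (\<lambda>r. k^2 * f r - partial_y b (partial_y b f) r)"

definition L_op ::
    "real \<Rightarrow> real \<Rightarrow> (nat \<Rightarrow> complex) \<Rightarrow> nat \<Rightarrow> complex
      \<Rightarrow> (real \<times> real \<Rightarrow> complex) \<Rightarrow> (real \<times> real \<Rightarrow> complex)" where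
  "L_op a b \<xi> i z q = L_factor_x a (k_coeff \<xi> i z) (L_factor_y b (k_coeff \<xi> i z) q)"

text \<open>The characteristic polynomial of the equation $L(z)\Delta(z)q = 0$ with
  $L(z) = \prod_i L_i(z)$, rewritten as a constant-coefficient equation by means of
  $L_i(z)K_i(z)q = 4c_i(z)k_i^2(z)q$.\<close>

definition char_poly ::
    "nat \<Rightarrow> real \<Rightarrow> (nat \<Rightarrow> complex) \<Rightarrow> (nat \<Rightarrow> complex) \<Rightarrow> real \<Rightarrow> real \<Rightarrow> complex
      \<Rightarrow> complex \<Rightarrow> complex \<Rightarrow> complex" where
  "char_poly N \<alpha> chat \<xi> S'0 \<tau>0 z \<rho> \<nu> =
     (z + of_real \<alpha>) *
       (\<Prod>i=1..N. ((k_coeff \<xi> i z)^2 - \<rho>^2) * ((k_coeff \<xi> i z)^2 - \<nu>^2))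
     - 4 * (\<Sum>i=1..N. c_coeff chat S'0 \<tau>0 i z * (k_coeff \<xi> i z)^2 *
         (\<Prod>j\<in>{1..N} - {i}. ((k_coeff \<xi> j z)^2 - \<rho>^2) * ((k_coeff \<xi> j z)^2 - \<nu>^2)))"

definition char_zeros ::
    "nat \<Rightarrow> real \<Rightarrow> (nat \<Rightarrow> complex) \<Rightarrow> (nat \<Rightarrow> complex) \<Rightarrow> real \<Rightarrow> real \<Rightarrow> complex
      \<Rightarrow> (complex \<times> complex) set" where
  "char_zeros N \<alpha> chat \<xi> S'0 \<tau>0 z = {(\<rho>, \<nu>). char_poly N \<alpha> chat \<xi> S'0 \<tau>0 z \<rho> \<nu> = 0}"

definition exceptional_set :: "nat \<Rightarrow> (nat \<Rightarrow> complex) \<Rightarrow> complex set" where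
  "exceptional_set N \<xi> =
     {z. (\<exists>i\<in>{1..N}. \<exists>j\<in>{1..N}. i \<noteq> j \<and> (k_coeff \<xi> i z)^2 = (k_coeff \<xi> j z)^2)
       \<or> (\<exists>i\<in>{1..N}. k_coeff \<xi> i z = 0)}"

definition exp_sol :: "(complex \<times> complex \<Rightarrow> complex) \<Rightarrow> complex \<times> complex \<Rightarrow> real \<times> real \<Rightarrow> complex" where
  "exp_sol \<gamma> = (\<lambda>(\<rho>, \<nu>) (x, y). \<gamma> (\<rho>, \<nu>) * exp (\<rho> * of_real x) * exp (\<nu> * of_real y))"

end

theory Submission imports Defs begin

text \<open>
  The two functions whose vanishing is compared agree up to sign.  Write \<open>e\<close> for one exponential
  \<open>\<gamma> e\<^sup>\<rho>\<^sup>x e\<^sup>\<nu>\<^sup>y\<close> and \<open>m\<^sub>i = (k\<^sub>i\<^sup>2 - \<rho>\<^sup>2) (k\<^sub>i\<^sup>2 - \<nu>\<^sup>2)\<close>.  The exponential is an eigenfunction of the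
  differential operator, \<open>L\<^sub>i e = m\<^sub>i e\<close>, while \<open>K\<^sub>i\<close> is a right inverse of \<open>L\<^sub>i\<close> up to a
  constant, \<open>L\<^sub>i K\<^sub>i e = 4 c\<^sub>i k\<^sub>i\<^sup>2 e\<close>.  Hence the commutator divided by \<open>m\<^sub>i\<close> is
  \<open>K\<^sub>i e - (4 c\<^sub>i k\<^sub>i\<^sup>2 / m\<^sub>i) e\<close>.  Dividing the characteristic equation by the product of all \<open>m\<^sub>j\<close> gives
  \<open>\<Sum>\<^sub>i 4 c\<^sub>i k\<^sub>i\<^sup>2 / m\<^sub>i = z + \<alpha>\<close>, so the sum over \<open>i\<close> of these quotients is \<open>\<Sum>\<^sub>i K\<^sub>i e - (z + \<alpha>) e = - \<Delta> e\<close>.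
  Summation over \<open>V\<close> gives \<open>- \<Delta> q\<close> (lemma \<open>commutator_sum_eq_neg_Delta\<close>).

  The analytic part is the identity for \<open>L\<^sub>i K\<^sub>i e\<close>.  The kernel in the norm \<open>\<bar>x\<bar> + \<bar>y\<bar>\<close> factors, so by
  Fubini \<open>K\<^sub>i e\<close> is a product of two one-dimensional integrals (\<open>K_op_exp_sol\<close>); each of these solves
  \<open>k\<^sup>2 A - A'' = 2 k e\<^sup>\<rho>\<^sup>x\<close> on the closed interval (\<open>exp_conv_deriv\<close>, \<open>exp_conv_deriv2\<close>).
\<close>

section \<open>The one-dimensional convolution with an exponential\<close>

text \<open>The convolution of the kernel \<open>e\<^bsup>-k\<bar>t\<bar>\<^esup>\<close> with \<open>e\<^bsup>\<rho>t\<^esup>\<close> on \<open>[-a, a]\<close> is split at \<open>t = x\<close>, where the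
  kernel centred at \<open>x\<close> has its kink: each of the two parts is smooth in \<open>x\<close>.\<close>

definition exp_conv :: "real \<Rightarrow> complex \<Rightarrow> complex \<Rightarrow> real \<Rightarrow> complex" where
  "exp_conv a k \<rho> x = integral {-a..a} (\<lambda>t. exp (- k * of_real \<bar>x - t\<bar>) * exp (\<rho> * of_real t))"

definition exp_conv_left :: "real \<Rightarrow> complex \<Rightarrow> complex \<Rightarrow> real \<Rightarrow> complex" where
  "exp_conv_left a k \<rho> x = exp (- k * of_real x) * integral {-a..x} (\<lambda>t. exp ((k + \<rho>) * of_real t))"

definition exp_conv_right :: "real \<Rightarrow> complex \<Rightarrow> complex \<Rightarrow> real \<Rightarrow> complex" where
  "exp_conv_right a k \<rho> x = exp (k * of_real x) * integral {x..a} (\<lambda>t. exp ((\<rho> - k) * of_real t))"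

lemma exp_conv_split:
  assumes x: "x \<in> {-a..a}"
  shows "exp_conv a k \<rho> x = exp_conv_left a k \<rho> x + exp_conv_right a k \<rho> x"
proof -
  let ?f = "\<lambda>t. exp (- k * of_real \<bar>x - t\<bar>) * exp (\<rho> * of_real t)"
  have "?f integrable_on {-a..a}"
    by (intro integrable_continuous_interval continuous_intros)
  then have "exp_conv a k \<rho> x = integral {-a..x} ?f + integral {x..a} ?f"
    unfolding exp_conv_def
    using x by (intro Henstock_Kurzweil_Integration.integral_combine[symmetric]) auto
  also have "integral {-a..x} ?f =
      integral {-a..x} (\<lambda>t. exp (- k * of_real x) * exp ((k + \<rho>) * of_real t))"
    by (rule integral_cong) (auto simp: exp_add[symmetric] algebra_simps)
  also have "integral {x..a} ?f =
      integral {x..a} (\<lambda>t. exp (k * of_real x) * exp ((\<rho> - k) * of_real t))"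
    by (rule integral_cong) (auto simp: exp_add[symmetric] algebra_simps)
  finally show ?thesis
    by (simp add: exp_conv_left_def exp_conv_right_def)
qed

lemma exp_has_vector_derivative:
  "((\<lambda>t. exp (c * of_real t)) has_vector_derivative c * exp (c * of_real x)) (at x within S)"
  for c :: complex
  by (auto intro!: derivative_eq_intros has_vector_derivative_real_field
      simp: algebra_simps)

lemma exp_conv_left_deriv:
  assumes x: "x \<in> {-a..a}"
  shows "(exp_conv_left a k \<rho> has_vector_derivative
      exp (\<rho> * of_real x) - k * exp_conv_left a k \<rho> x) (at x within {-a..a})"
proof -
  have "((\<lambda>x. integral {-a..x} (\<lambda>t. exp ((k + \<rho>) * of_real t))) has_vector_derivative
      exp ((k + \<rho>) * of_real x)) (at x within {-a..a})"
    by (rule integral_has_vector_derivative[OF _ x]) (intro continuous_intros)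
  from has_vector_derivative_mult[OF exp_has_vector_derivative[of "-k"] this]
  have "(exp_conv_left a k \<rho> has_vector_derivative
      exp (- k * of_real x) * exp ((k + \<rho>) * of_real x)
        + - k * exp (- k * of_real x) * integral {-a..x} (\<lambda>t. exp ((k + \<rho>) * of_real t)))
      (at x within {-a..a})"
    unfolding exp_conv_left_def[abs_def] .
  moreover have "exp (- k * of_real x) * exp ((k + \<rho>) * of_real x) = exp (\<rho> * of_real x)"
    by (simp add: exp_add[symmetric] algebra_simps)
  ultimately show ?thesis
    by (simp add: exp_conv_left_def algebra_simps)
qed

lemma exp_conv_right_deriv:
  assumes x: "x \<in> {-a..a}"
  shows "(exp_conv_right a k \<rho> has_vector_derivative
      k * exp_conv_right a k \<rho> x - exp (\<rho> * of_real x)) (at x within {-a..a})"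
proof -
  have "((\<lambda>x. integral {x..a} (\<lambda>t. exp ((\<rho> - k) * of_real t))) has_vector_derivative
      - exp ((\<rho> - k) * of_real x)) (at x within {-a..a})"
    by (rule integral_has_vector_derivative'[OF _ x]) (intro continuous_intros)
  from has_vector_derivative_mult[OF exp_has_vector_derivative[of k] this]
  have "(exp_conv_right a k \<rho> has_vector_derivative
      exp (k * of_real x) * - exp ((\<rho> - k) * of_real x)
        + k * exp (k * of_real x) * integral {x..a} (\<lambda>t. exp ((\<rho> - k) * of_real t)))
      (at x within {-a..a})"
    unfolding exp_conv_right_def[abs_def] .
  moreover have "exp (k * of_real x) * exp ((\<rho> - k) * of_real x) = exp (\<rho> * of_real x)"
    by (simp add: exp_add[symmetric] algebra_simps)
  ultimately show ?thesis
    by (simp add: exp_conv_right_def algebra_simps)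
qed

text \<open>The boundary terms \<open>e\<^bsup>\<rho>x\<^esup>\<close> of the two parts cancel in the first derivative, because the kernel
  is continuous at its kink; in the second derivative they add up, because its slope jumps there
  by \<open>- 2 k\<close>.\<close>

lemma exp_conv_deriv:
  assumes x: "x \<in> {-a..a}"
  shows "(exp_conv a k \<rho> has_vector_derivative
      k * (exp_conv_right a k \<rho> x - exp_conv_left a k \<rho> x)) (at x within {-a..a})"
proof -
  have "((\<lambda>x. exp_conv_left a k \<rho> x + exp_conv_right a k \<rho> x) has_vector_derivative
      k * (exp_conv_right a k \<rho> x - exp_conv_left a k \<rho> x)) (at x within {-a..a})"
    by (rule has_vector_derivative_eq_rhs
        [OF has_vector_derivative_add[OF exp_conv_left_deriv[OF x] exp_conv_right_deriv[OF x]]])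
      (simp add: algebra_simps)
  then show ?thesis
    by (rule has_vector_derivative_transform[OF x, rotated]) (rule exp_conv_split)
qed

lemma exp_conv_deriv2:
  assumes x: "x \<in> {-a..a}"
  shows "((\<lambda>x. k * (exp_conv_right a k \<rho> x - exp_conv_left a k \<rho> x)) has_vector_derivative
      k\<^sup>2 * exp_conv a k \<rho> x - 2 * k * exp (\<rho> * of_real x)) (at x within {-a..a})"
  by (rule has_vector_derivative_eq_rhs
      [OF has_vector_derivative_mult_right
        [OF has_vector_derivative_diff[OF exp_conv_right_deriv[OF x] exp_conv_left_deriv[OF x]]]])
    (simp add: exp_conv_split[OF x] algebra_simps power2_eq_square)

section \<open>The differential operator on separated functions\<close>

text \<open>The one-sided derivative at an end point only sees values inside the interval, so \<open>f\<close> may be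
  replaced by a function \<open>g\<close> whose derivatives are known there.\<close>

lemma vector_derivative_twice_on_interval:
  fixes f :: "real \<Rightarrow> complex"
  assumes a: "a > 0" and t: "t \<in> {-a..a}"
    and f: "\<And>s. s \<in> {-a..a} \<Longrightarrow> f s = g s"
    and g: "\<And>s. s \<in> {-a..a} \<Longrightarrow> (g has_vector_derivative g' s) (at s within {-a..a})"
    and g': "\<And>s. s \<in> {-a..a} \<Longrightarrow> (g' has_vector_derivative g'' s) (at s within {-a..a})"
  shows "vector_derivative (\<lambda>s. vector_derivative f (at s within {-a..a})) (at t within {-a..a})
    = g'' t"
proof -
  have deriv: "vector_derivative h (at s within {-a..a}) = d"
    if "(h has_vector_derivative d) (at s within {-a..a})" "s \<in> {-a..a}" for h s and d :: complex
    using a that by (intro vector_derivative_within_closed_interval) auto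
  have "vector_derivative f (at s within {-a..a}) = g' s" if "s \<in> {-a..a}" for s
    using has_vector_derivative_transform[OF that f g[OF that]] that by (intro deriv) auto
  from has_vector_derivative_transform[OF t this g'[OF t]] show ?thesis
    using t by (intro deriv) auto
qed

text \<open>On functions with separated variables the operator \<open>L\<^sub>i\<close> acts factor by factor, up to and
  including the boundary of the rectangle.  This is applied to the exponentials as well as to
  their images under \<open>K\<^sub>i\<close>.\<close>

lemma L_op_separated:
  fixes A A1 A2 B B1 B2 :: "real \<Rightarrow> complex"
  assumes a: "a > 0" and b: "b > 0" and r: "(x, y) \<in> Omega_bar a b"
    and f: "\<And>x y. (x, y) \<in> Omega_bar a b \<Longrightarrow> f (x, y) = C * A x * B y"
    and A: "\<And>s. s \<in> {-a..a} \<Longrightarrow> (A has_vector_derivative A1 s) (at s within {-a..a})"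
    and A1: "\<And>s. s \<in> {-a..a} \<Longrightarrow> (A1 has_vector_derivative A2 s) (at s within {-a..a})"
    and B: "\<And>s. s \<in> {-b..b} \<Longrightarrow> (B has_vector_derivative B1 s) (at s within {-b..b})"
    and B1: "\<And>s. s \<in> {-b..b} \<Longrightarrow> (B1 has_vector_derivative B2 s) (at s within {-b..b})"
  shows "L_op a b \<xi> i z f (x, y) =
    C * ((k_coeff \<xi> i z)\<^sup>2 * A x - A2 x) * ((k_coeff \<xi> i z)\<^sup>2 * B y - B2 y)"
proof -
  define k where "k = k_coeff \<xi> i z"
  have x: "x \<in> {-a..a}" and y: "y \<in> {-b..b}"
    using r by (auto simp: Omega_bar_def)
  have Ly: "L_factor_y b k f (s, y) = C * (k\<^sup>2 * B y - B2 y) * A s" if s: "s \<in> {-a..a}" for s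
  proof -
    have "partial_y b (partial_y b f) (s, y) = C * A s * B2 y"
      unfolding partial_y_def prod.case
      by (rule vector_derivative_twice_on_interval[OF b y, where g = "\<lambda>t. C * A s * B t"
            and g' = "\<lambda>t. C * A s * B1 t" and g'' = "\<lambda>t. C * A s * B2 t"])
        (use s f B B1 in \<open>auto simp: Omega_bar_def intro!: has_vector_derivative_mult_right\<close>)
    then show ?thesis
      using f[of s y] s y by (simp add: L_factor_y_def Omega_bar_def algebra_simps)
  qed
  have "partial_x a (partial_x a (L_factor_y b k f)) (x, y) = C * (k\<^sup>2 * B y - B2 y) * A2 x"
    unfolding partial_x_def prod.case
    by (rule vector_derivative_twice_on_interval[OF a x,
          where g = "\<lambda>t. C * (k\<^sup>2 * B y - B2 y) * A t"
          and g' = "\<lambda>t. C * (k\<^sup>2 * B y - B2 y) * A1 t"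
          and g'' = "\<lambda>t. C * (k\<^sup>2 * B y - B2 y) * A2 t"])
      (use Ly A A1 in \<open>auto intro!: has_vector_derivative_mult_right\<close>)
  then have "L_op a b \<xi> i z f (x, y) =
      k\<^sup>2 * (C * (k\<^sup>2 * B y - B2 y) * A x) - C * (k\<^sup>2 * B y - B2 y) * A2 x"
    unfolding L_op_def L_factor_x_def k_def[symmetric] Ly[OF x] by simp
  also have "\<dots> = C * (k\<^sup>2 * A x - A2 x) * (k\<^sup>2 * B y - B2 y)"
    by (simp add: algebra_simps)
  finally show ?thesis
    by (simp only: k_def)
qed

lemma L_op_exp_sol:
  assumes a: "a > 0" and b: "b > 0" and r: "r \<in> Omega_bar a b"
  shows "L_op a b \<xi> i z (exp_sol \<gamma> (\<rho>, \<nu>)) r =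
    ((k_coeff \<xi> i z)\<^sup>2 - \<rho>\<^sup>2) * ((k_coeff \<xi> i z)\<^sup>2 - \<nu>\<^sup>2) * exp_sol \<gamma> (\<rho>, \<nu>) r"
proof -
  obtain x y where xy: "r = (x, y)" by (cases r)
  have deriv2: "((\<lambda>t. c * exp (c * of_real t)) has_vector_derivative c\<^sup>2 * exp (c * of_real s))
      (at s within S)" for c :: complex and s S
    using has_vector_derivative_mult_right[OF exp_has_vector_derivative[of c s S], of c]
    by (simp add: power2_eq_square mult.assoc)
  have "L_op a b \<xi> i z (exp_sol \<gamma> (\<rho>, \<nu>)) (x, y) = \<gamma> (\<rho>, \<nu>)
      * ((k_coeff \<xi> i z)\<^sup>2 * exp (\<rho> * of_real x) - \<rho>\<^sup>2 * exp (\<rho> * of_real x))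
      * ((k_coeff \<xi> i z)\<^sup>2 * exp (\<nu> * of_real y) - \<nu>\<^sup>2 * exp (\<nu> * of_real y))"
    by (rule L_op_separated[OF a b])
      (use r xy in \<open>auto simp: exp_sol_def intro: exp_has_vector_derivative deriv2\<close>)
  then show ?thesis
    by (simp add: xy exp_sol_def algebra_simps)
qed

section \<open>The integral operator on exponentials\<close>

lemma Omega_eq_box: "Omega a b = box (-a, -b) (a, b)"
  by (simp add: Omega_def Omega_bar_def cbox_Pair_eq flip: interior_cbox)

lemma Omega_subset_Omega_bar: "Omega a b \<subseteq> Omega_bar a b"
  by (simp add: Omega_def interior_subset)

lemma continuous_on_K_op_integrand:
  "continuous_on S (\<lambda>r'. exp (- k * of_real (norm1 (r - r'))) * exp_sol \<gamma> (\<rho>, \<nu>) r')"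
  unfolding norm1_def exp_sol_def case_prod_beta by (intro continuous_intros)

lemma K_op_exp_sol:
  "K_op a b chat \<xi> S'0 \<tau>0 i z (exp_sol \<gamma> (\<rho>, \<nu>)) (x, y) =
    c_coeff chat S'0 \<tau>0 i z * \<gamma> (\<rho>, \<nu>)
      * exp_conv a (k_coeff \<xi> i z) \<rho> x * exp_conv b (k_coeff \<xi> i z) \<nu> y"
proof -
  define k where "k = k_coeff \<xi> i z"
  define F where "F = (\<lambda>r'. exp (- k * of_real (norm1 ((x, y) - r'))) * exp_sol \<gamma> (\<rho>, \<nu>) r')"
  let ?f = "\<lambda>s. exp (- k * of_real \<bar>x - s\<bar>) * exp (\<rho> * of_real s)"
  let ?g = "\<lambda>t. exp (- k * of_real \<bar>y - t\<bar>) * exp (\<nu> * of_real t)"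
  have "integral (Omega a b) F = integral (cbox (-a, -b) (a, b)) F"
    by (simp add: Omega_eq_box integral_open_interval)
  also have "\<dots> = integral (cbox (-a) a) (\<lambda>s. integral (cbox (-b) b) (\<lambda>t. F (s, t)))"
    using integral_prod_continuous[of "-a" "-b" a b F] continuous_on_K_op_integrand
    by (simp add: F_def)
  also have "(\<lambda>s t. F (s, t)) = (\<lambda>s t. \<gamma> (\<rho>, \<nu>) * ?f s * ?g t)"
    by (auto simp: F_def norm1_def exp_sol_def fun_eq_iff algebra_simps exp_diff exp_minus divide_inverse)
  also have "integral (cbox (-a) a) (\<lambda>s. integral (cbox (-b) b) (\<lambda>t. \<gamma> (\<rho>, \<nu>) * ?f s * ?g t))
      = \<gamma> (\<rho>, \<nu>) * exp_conv a k \<rho> x * exp_conv b k \<nu> y"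
    by (simp add: exp_conv_def)
  finally show ?thesis
    by (simp add: K_op_def F_def k_def)
qed

text \<open>In the sense of distributions \<open>L\<^sub>i\<close> maps the kernel \<open>e\<^bsup>-k\<^sub>i(\<bar>x\<bar> + \<bar>y\<bar>)\<^esup>\<close> to \<open>4 k\<^sub>i\<^sup>2\<close> times the Dirac
  measure at the origin, one factor \<open>2 k\<^sub>i\<close> coming from each variable.\<close>

lemma L_op_K_op_exp_sol:
  assumes a: "a > 0" and b: "b > 0" and r: "r \<in> Omega_bar a b"
  shows "L_op a b \<xi> i z (K_op a b chat \<xi> S'0 \<tau>0 i z (exp_sol \<gamma> (\<rho>, \<nu>))) r =
    4 * c_coeff chat S'0 \<tau>0 i z * (k_coeff \<xi> i z)\<^sup>2 * exp_sol \<gamma> (\<rho>, \<nu>) r"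
proof -
  obtain x y where xy: "r = (x, y)" by (cases r)
  define k where "k = k_coeff \<xi> i z"
  have "L_op a b \<xi> i z (K_op a b chat \<xi> S'0 \<tau>0 i z (exp_sol \<gamma> (\<rho>, \<nu>))) (x, y) =
      c_coeff chat S'0 \<tau>0 i z * \<gamma> (\<rho>, \<nu>)
        * ((k_coeff \<xi> i z)\<^sup>2 * exp_conv a k \<rho> x
            - (k\<^sup>2 * exp_conv a k \<rho> x - 2 * k * exp (\<rho> * of_real x)))
        * ((k_coeff \<xi> i z)\<^sup>2 * exp_conv b k \<nu> y
            - (k\<^sup>2 * exp_conv b k \<nu> y - 2 * k * exp (\<nu> * of_real y)))"
    by (rule L_op_separated[OF a b r[unfolded xy]])
      (auto simp: K_op_exp_sol k_def intro: exp_conv_deriv exp_conv_deriv2)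
  then show ?thesis
    by (simp add: xy k_def exp_sol_def power2_eq_square)
qed

lemma K_op_cmult_on_Omega:
  assumes "\<And>r'. r' \<in> Omega a b \<Longrightarrow> f r' = m * g r'"
  shows "K_op a b chat \<xi> S'0 \<tau>0 i z f r = m * K_op a b chat \<xi> S'0 \<tau>0 i z g r"
proof -
  have "integral (Omega a b) (\<lambda>r'. exp (- k_coeff \<xi> i z * of_real (norm1 (r - r'))) * f r') =
      integral (Omega a b) (\<lambda>r'. m * (exp (- k_coeff \<xi> i z * of_real (norm1 (r - r'))) * g r'))"
    by (rule integral_cong) (simp add: assms)
  then show ?thesis
    by (simp add: K_op_def)
qed

lemma K_op_sum_exp_sol:
  assumes "finite V"
  shows "K_op a b chat \<xi> S'0 \<tau>0 i z (\<lambda>r. \<Sum>(\<rho>, \<nu>)\<in>V. exp_sol \<gamma> (\<rho>, \<nu>) r) r =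
    (\<Sum>(\<rho>, \<nu>)\<in>V. K_op a b chat \<xi> S'0 \<tau>0 i z (exp_sol \<gamma> (\<rho>, \<nu>)) r)"
proof -
  have "(\<lambda>r'. exp (- k_coeff \<xi> i z * of_real (norm1 (r - r'))) * exp_sol \<gamma> p r')
      integrable_on Omega a b" for p
    using integrable_continuous[OF continuous_on_K_op_integrand]
    by (cases p) (simp only: Omega_eq_box integrable_on_open_interval)
  then show ?thesis
    using assms
    by (simp add: K_op_def sum_distrib_left integral_sum split_def)
qed

section \<open>The commutator sum\<close>

text \<open>Dividing the characteristic equation by the nonzero product over \<open>j\<close> of the factors
  \<open>(k\<^sub>j\<^sup>2 - \<rho>\<^sup>2) (k\<^sub>j\<^sup>2 - \<nu>\<^sup>2)\<close> leaves a sum of simple quotients.\<close>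

lemma char_zeros_partial_fractions:
  assumes zero: "(\<rho>, \<nu>) \<in> char_zeros N \<alpha> chat \<xi> S'0 \<tau>0 z"
    and nz: "\<And>i. i \<in> {1..N} \<Longrightarrow> ((k_coeff \<xi> i z)\<^sup>2 - \<rho>\<^sup>2) * ((k_coeff \<xi> i z)\<^sup>2 - \<nu>\<^sup>2) \<noteq> 0"
  shows "(\<Sum>i=1..N. 4 * c_coeff chat S'0 \<tau>0 i z * (k_coeff \<xi> i z)\<^sup>2
      / (((k_coeff \<xi> i z)\<^sup>2 - \<rho>\<^sup>2) * ((k_coeff \<xi> i z)\<^sup>2 - \<nu>\<^sup>2))) = z + of_real \<alpha>"
proof -
  define m where "m i = ((k_coeff \<xi> i z)\<^sup>2 - \<rho>\<^sup>2) * ((k_coeff \<xi> i z)\<^sup>2 - \<nu>\<^sup>2)" for i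
  define d where "d i = c_coeff chat S'0 \<tau>0 i z * (k_coeff \<xi> i z)\<^sup>2" for i
  have m0: "m i \<noteq> 0" if "i \<in> {1..N}" for i
    using nz[OF that] by (simp add: m_def)
  then have M0: "prod m {1..N} \<noteq> 0" by simp
  have "(\<Sum>i=1..N. 4 * d i / m i) * prod m {1..N} = (\<Sum>i=1..N. 4 * (d i * prod m ({1..N} - {i})))"
    unfolding sum_distrib_right
  proof (rule sum.cong)
    fix i assume i: "i \<in> {1..N}"
    then have "prod m {1..N} = m i * prod m ({1..N} - {i})"
      by (simp add: prod.remove)
    then show "4 * d i / m i * prod m {1..N} = 4 * (d i * prod m ({1..N} - {i}))"
      using m0[OF i] by simp
  qed simp
  also have "\<dots> = (z + of_real \<alpha>) * prod m {1..N}"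
    using zero by (simp add: char_zeros_def char_poly_def m_def d_def sum_distrib_left)
  finally show ?thesis
    using M0 by (simp add: m_def d_def mult.assoc)
qed

text \<open>Each commutator, divided by its eigenvalue of \<open>L\<^sub>i\<close>, is \<open>K\<^sub>i\<close> of the exponential minus a multiple
  of the exponential, and the characteristic equation makes these multiples add up to \<open>z + \<alpha>\<close>.\<close>

lemma commutator_sum_eq_neg_Delta:
  assumes a: "a > 0" and b: "b > 0" and r: "r \<in> Omega_bar a b" and fin: "finite V"
    and zeros: "V \<subseteq> char_zeros N \<alpha> chat \<xi> S'0 \<tau>0 z"
    and nz: "\<forall>(\<rho>, \<nu>)\<in>V. \<forall>i\<in>{1..N}.
      ((k_coeff \<xi> i z)^2 - \<rho>^2) * ((k_coeff \<xi> i z)^2 - \<nu>^2) \<noteq> 0"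
  shows "(\<Sum>i=1..N. \<Sum>(\<rho>, \<nu>)\<in>V.
        (K_op a b chat \<xi> S'0 \<tau>0 i z (L_op a b \<xi> i z (exp_sol \<gamma> (\<rho>, \<nu>))) r
          - L_op a b \<xi> i z (K_op a b chat \<xi> S'0 \<tau>0 i z (exp_sol \<gamma> (\<rho>, \<nu>))) r)
        / (((k_coeff \<xi> i z)^2 - \<rho>^2) * ((k_coeff \<xi> i z)^2 - \<nu>^2)))
    = - Delta_op a b N \<alpha> chat \<xi> S'0 \<tau>0 z (\<lambda>r. \<Sum>(\<rho>, \<nu>)\<in>V. exp_sol \<gamma> (\<rho>, \<nu>) r) r"
proof -
  define K where "K = K_op a b chat \<xi> S'0 \<tau>0"
  define m where "m i \<rho> \<nu> = ((k_coeff \<xi> i z)\<^sup>2 - \<rho>\<^sup>2) * ((k_coeff \<xi> i z)\<^sup>2 - \<nu>\<^sup>2)" for i \<rho> \<nu>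
  define d where "d i = 4 * c_coeff chat S'0 \<tau>0 i z * (k_coeff \<xi> i z)\<^sup>2" for i
  let ?e = "\<lambda>\<rho> \<nu>. exp_sol \<gamma> (\<rho>, \<nu>)"
  let ?Q = "\<lambda>i \<rho> \<nu>. (K i z (L_op a b \<xi> i z (?e \<rho> \<nu>)) r - L_op a b \<xi> i z (K i z (?e \<rho> \<nu>)) r)
    / m i \<rho> \<nu>"
  have quotient: "?Q i \<rho> \<nu> = K i z (?e \<rho> \<nu>) r - d i / m i \<rho> \<nu> * ?e \<rho> \<nu> r"
    if V: "(\<rho>, \<nu>) \<in> V" and i: "i \<in> {1..N}" for i \<rho> \<nu>
  proof -
    have "K i z (L_op a b \<xi> i z (?e \<rho> \<nu>)) r = m i \<rho> \<nu> * K i z (?e \<rho> \<nu>) r"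
      unfolding K_def m_def
      using L_op_exp_sol[OF a b] Omega_subset_Omega_bar by (intro K_op_cmult_on_Omega) blast
    moreover have "L_op a b \<xi> i z (K i z (?e \<rho> \<nu>)) r = d i * ?e \<rho> \<nu> r"
      unfolding K_def d_def by (rule L_op_K_op_exp_sol[OF a b r])
    moreover have "m i \<rho> \<nu> \<noteq> 0"
      using nz V i by (auto simp: m_def)
    ultimately show ?thesis
      by (simp add: diff_divide_distrib)
  qed
  have sum_i: "(\<Sum>i=1..N. ?Q i \<rho> \<nu>) = (\<Sum>i=1..N. K i z (?e \<rho> \<nu>) r) - (z + of_real \<alpha>) * ?e \<rho> \<nu> r"
    if V: "(\<rho>, \<nu>) \<in> V" for \<rho> \<nu>
  proof -
    have "(\<Sum>i=1..N. d i / m i \<rho> \<nu>) = z + of_real \<alpha>"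
      unfolding d_def m_def
      by (rule char_zeros_partial_fractions) (use V zeros nz in auto)
    then have "(\<Sum>i=1..N. d i / m i \<rho> \<nu> * ?e \<rho> \<nu> r) = (z + of_real \<alpha>) * ?e \<rho> \<nu> r"
      by (simp only: sum_distrib_right[symmetric])
    moreover have "(\<Sum>i=1..N. ?Q i \<rho> \<nu>) =
        (\<Sum>i=1..N. K i z (?e \<rho> \<nu>) r - d i / m i \<rho> \<nu> * ?e \<rho> \<nu> r)"
      by (rule sum.cong[OF refl quotient[OF V]])
    ultimately show ?thesis
      by (simp only: sum_subtractf)
  qed
  have "(\<Sum>i=1..N. \<Sum>(\<rho>, \<nu>)\<in>V. ?Q i \<rho> \<nu>) = (\<Sum>(\<rho>, \<nu>)\<in>V. \<Sum>i=1..N. ?Q i \<rho> \<nu>)"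
    unfolding split_def by (rule sum.swap)
  also have "\<dots> = (\<Sum>(\<rho>, \<nu>)\<in>V. (\<Sum>i=1..N. K i z (?e \<rho> \<nu>) r) - (z + of_real \<alpha>) * ?e \<rho> \<nu> r)"
    using sum_i by (intro sum.cong) auto
  also have "\<dots> = (\<Sum>(\<rho>, \<nu>)\<in>V. \<Sum>i=1..N. K i z (?e \<rho> \<nu>) r)
      - (z + of_real \<alpha>) * (\<Sum>(\<rho>, \<nu>)\<in>V. ?e \<rho> \<nu> r)"
    by (simp add: split_def sum_subtractf sum_distrib_left)
  also have "(\<Sum>(\<rho>, \<nu>)\<in>V. \<Sum>i=1..N. K i z (?e \<rho> \<nu>) r) =
      (\<Sum>i=1..N. \<Sum>(\<rho>, \<nu>)\<in>V. K i z (?e \<rho> \<nu>) r)"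
    unfolding split_def by (rule sum.swap)
  finally show ?thesis
    by (simp only: Delta_op_def K_op_sum_exp_sol[OF fin] K_def m_def minus_diff_eq)
qed

theorem theorem3p3:
  fixes a b \<alpha> \<tau>0 S'0 :: real and N :: nat
    and chat \<xi> :: "nat \<Rightarrow> complex" and z :: complex
    and V :: "(complex \<times> complex) set"
    and \<gamma> :: "complex \<times> complex \<Rightarrow> complex"
    and q :: "real \<times> real \<Rightarrow> complex"
  assumes "a > 0" and "b > 0" and "N \<ge> 1" and "\<alpha> > 0" and "\<tau>0 > 0" and "S'0 \<noteq> 0"
    and "\<forall>i\<in>{1..N}. chat i \<noteq> 0"
    and "\<forall>r\<in>Omega_bar a b. \<forall>r'\<in>Omega_bar a b. connectivity N chat \<xi> r r' \<in> \<real>"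
    and "z \<noteq> - of_real \<alpha>"
    and "z \<notin> exceptional_set N \<xi>"
    and "finite V" and "V \<subseteq> char_zeros N \<alpha> chat \<xi> S'0 \<tau>0 z"
    and quotients_defined: "\<forall>(\<rho>, \<nu>)\<in>V. \<forall>i\<in>{1..N}.
      ((k_coeff \<xi> i z)^2 - \<rho>^2) * ((k_coeff \<xi> i z)^2 - \<nu>^2) \<noteq> 0"
    and "q = (\<lambda>r. \<Sum>(\<rho>, \<nu>)\<in>V. exp_sol \<gamma> (\<rho>, \<nu>) r)"
  shows "(\<forall>r\<in>Omega_bar a b. Delta_op a b N \<alpha> chat \<xi> S'0 \<tau>0 z q r = 0) \<longleftrightarrow>
    (\<forall>r\<in>Omega_bar a b.
      (\<Sum>i=1..N. \<Sum>(\<rho>, \<nu>)\<in>V.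
        (K_op a b chat \<xi> S'0 \<tau>0 i z (L_op a b \<xi> i z (exp_sol \<gamma> (\<rho>, \<nu>))) r
          - L_op a b \<xi> i z (K_op a b chat \<xi> S'0 \<tau>0 i z (exp_sol \<gamma> (\<rho>, \<nu>))) r)
        / (((k_coeff \<xi> i z)^2 - \<rho>^2) * ((k_coeff \<xi> i z)^2 - \<nu>^2))) = 0)"
  using commutator_sum_eq_neg_Delta[OF \<open>a > 0\<close> \<open>b > 0\<close> _ \<open>finite V\<close>
      \<open>V \<subseteq> char_zeros N \<alpha> chat \<xi> S'0 \<tau>0 z\<close> quotients_defined, of _ \<gamma>]
  by (simp add: \<open>q = _\<close>)

end
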